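(* Let $a$ and $b$ be any fixed numbers with $0<a<b<\infty$. Then the inequality $$\int_a^b\left(\frac{1}{x}\int_a^x f(t)\,dt\right)^2 dx\leq \frac{4}{1+4\alpha^2}\int_a^b [f(x)]^2\,dx,$$ where $\alpha$ is the only solution of the equation $$\tan\left(\alpha\log\frac{b}{a}\right)+2\alpha=0$$ in the interval $\left(\frac{\pi}{2\log\frac{b}{a}},\frac{\pi}{\log\frac{b}{a}}\right)$, holds for every $f\in L^2[a,b]$. Moreover, equality in this inequality is attained for $$f_{a,b}(x)=x^{-1/2}\left(2\alpha\cos(\alpha\log x)+\sin(\alpha\log x)\right).$$
   Context: $\log$ denotes the natural logarithm, and $L^2[a,b]$ is the space of (real-valued) square-integrable functions on $[a,b]$.
   Formalization: In the extremal function, log x is replaced by log(x/a): as printed, equality fails unless sin(α log a) = 0 (e.g. it fails for a = 2, b = 6); when sin(α log a) = 0, in particular for a = 1, the two functions agree up to sign. *)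

theory Defs
  imports "HOL-Analysis.Analysis"
begin

(* Elements of L^2[a,b] are represented by functions on the whole line; only
   the values on {a..b} matter, and functions equal almost everywhere are not
   identified. *)
definition L2_interval :: "real \<Rightarrow> real \<Rightarrow> (real \<Rightarrow> real) set" where
  "L2_interval a b =
     {f. set_borel_measurable lebesgue {a..b} f \<and>
         set_integrable lebesgue {a..b} (\<lambda>x. (f x)\<^sup>2)}"

definition hardy_root :: "real \<Rightarrow> real \<Rightarrow> real \<Rightarrow> bool" where
  "hardy_root a b \<alpha> \<longleftrightarrow>
     \<alpha> \<in> {pi / (2 * ln (b / a)) <..< pi / ln (b / a)} \<and>
     tan (\<alpha> * ln (b / a)) + 2 * \<alpha> = 0"

(* The logarithm is taken of x / a, so that the primitive of this function is
   2 * sqrt x * sin (\<alpha> * ln (x / a)), which vanishes at x = a. With ln x in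
   place of ln (x / a) equality in the Hardy inequality fails in general
   (e.g. for a = 2, b = 6); the two agree for a = 1. *)
definition hardy_extremal :: "real \<Rightarrow> real \<Rightarrow> real \<Rightarrow> real" where
  "hardy_extremal a \<alpha> x =
     x powr (- 1 / 2) * (2 * \<alpha> * cos (\<alpha> * ln (x / a)) + sin (\<alpha> * ln (x / a)))"

end

(* Schur test. Let h be the extremal function and H its primitive with H(a) = 0. Then h is
   positive on [a,b), h(b) = 0 (this is the equation for alpha), and h' = -(1/4 + alpha^2) H / x^2.
   By Cauchy-Schwarz, (int_a^x f)^2 <= H(x) int_a^x f^2/h; integrating against 1/x^2 and
   exchanging the integrals leaves int_a^b f(t)^2/h(t) (int_t^b H/x^2 dx) dt, whose inner integral
   equals h(t)/(1/4 + alpha^2). Equality for f = h follows by integrating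
   (h H)' = h^2 - (1/4 + alpha^2) H^2/x^2, since h H vanishes at both ends. *)
theory Submission
  imports Defs
begin


section \<open>Lebesgue measure and an abstract weighted Schur test\<close>

text \<open>Needed for exchanging integrals over the completed measure. A countable cover that works
  for \<open>lborel\<close> works for its completion, since completion keeps sets and their
  measures.\<close>

lemma sigma_finite_lebesgue: "sigma_finite_measure (lebesgue :: 'a::euclidean_space measure)"
proof
  obtain A :: "'a set set" where "countable A" "A \<subseteq> sets lborel" "\<Union>A = space lborel"
      "\<forall>a\<in>A. emeasure lborel a \<noteq> \<infinity>"
    using lborel.sigma_finite_countable by blast
  then show "\<exists>A. countable A \<and> A \<subseteq> sets (lebesgue :: 'a measure) \<and> \<Union>A = space lebesgue \<and>
      (\<forall>a\<in>A. emeasure lebesgue a \<noteq> \<infinity>)"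
    by (intro exI[of _ A]) auto
qed

lemma nn_integral_lebesgue_continuous:
  fixes h :: "real \<Rightarrow> real"
  assumes "continuous_on {a..b} h" "\<And>x. x \<in> {a..b} \<Longrightarrow> 0 \<le> h x" "(h has_integral I) {a..b}"
  shows "(\<integral>\<^sup>+x. ennreal (h x) * indicator {a..b} x \<partial>lebesgue) = ennreal I"
  using nn_integral_has_integral_lebesgue'[of "{a..b}" h I] assms
  by (simp add: nn_integral_completion)

text \<open>Cauchy-Schwarz for the splitting f = (f / sqrt h) * sqrt h, where the integral of h is
  \<open>I\<close>. The weighted integral is taken in the extended reals, so it may be
  infinite.\<close>

lemma square_integral_le_weighted:
  fixes f h :: "real \<Rightarrow> real"
  assumes f: "set_borel_measurable lebesgue {a..x} f"
    and h: "continuous_on {a..x} h" "\<And>t. t \<in> {a..x} \<Longrightarrow> 0 < h t" "(h has_integral I) {a..x}"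
  shows "ennreal ((LINT t:{a..x}|lebesgue. f t)\<^sup>2)
    \<le> (\<integral>\<^sup>+t. ennreal ((f t)\<^sup>2 / h t) * indicator {a..x} t \<partial>lebesgue) * ennreal I"
proof -
  have mf[measurable]: "(\<lambda>t. indicator {a..x} t * f t) \<in> borel_measurable lebesgue"
    using f by (simp add: set_borel_measurable_def)
  have "(\<lambda>t. indicator {a..x} t *\<^sub>R h t) \<in> borel_measurable borel"
    by (intro borel_measurable_continuous_on_indicator h) auto
  then have mh[measurable]: "(\<lambda>t. indicator {a..x} t * h t) \<in> borel_measurable lebesgue"
    by (simp add: measurable_completion)
  \<comment> \<open>The indicators sit inside the factors because \<open>f\<close> and
    \<open>h\<close> are only controlled on {a..x}; outside it \<open>?u\<close> is 0 / 0 =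
    0.\<close>
  let ?u = "\<lambda>t. \<bar>indicator {a..x} t * f t\<bar> / sqrt (indicator {a..x} t * h t)"
  let ?v = "\<lambda>t. sqrt (indicator {a..x} t * h t)"
  have uv: "ennreal (norm (indicator {a..x} t *\<^sub>R f t)) = ennreal (?u t) * ennreal (?v t)" for t
    using h(2)[of t] by (cases "t \<in> {a..x}") (auto simp flip: ennreal_mult)
  have u2: "ennreal (?u t) ^ 2 = ennreal ((f t)\<^sup>2 / h t) * indicator {a..x} t" for t
    using h(2)[of t] by (cases "t \<in> {a..x}") (auto simp: ennreal_power power_divide)
  have v2: "ennreal (?v t) ^ 2 = ennreal (h t) * indicator {a..x} t" for t
    using h(2)[of t] by (cases "t \<in> {a..x}") (auto simp: ennreal_power)
  \<comment> \<open>If f is not integrable on {a..x}, its integral has the default value 0 and the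
    bound is trivial.\<close>
  have "ennreal \<bar>LINT t:{a..x}|lebesgue. f t\<bar>
      \<le> (\<integral>\<^sup>+t. norm (indicator {a..x} t *\<^sub>R f t) \<partial>lebesgue)"
    unfolding set_lebesgue_integral_def
    using integral_norm_bound_ennreal[of lebesgue "\<lambda>t. indicator {a..x} t *\<^sub>R f t"]
    by (cases "integrable lebesgue (\<lambda>t. indicator {a..x} t *\<^sub>R f t)")
      (auto simp: not_integrable_integral_eq)
  also have "\<dots> = (\<integral>\<^sup>+t. ennreal (?u t) * ennreal (?v t) \<partial>lebesgue)"
    by (simp only: uv)
  finally have "ennreal \<bar>LINT t:{a..x}|lebesgue. f t\<bar> ^ 2
      \<le> (\<integral>\<^sup>+t. ennreal (?u t) * ennreal (?v t) \<partial>lebesgue) ^ 2"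
    by (rule power_mono) simp
  also have "\<dots> \<le> (\<integral>\<^sup>+t. ennreal (?u t) ^ 2 \<partial>lebesgue) * (\<integral>\<^sup>+t. ennreal (?v t) ^ 2 \<partial>lebesgue)"
    by (rule Cauchy_Schwarz_nn_integral) measurable
  also have "(\<integral>\<^sup>+t. ennreal (?v t) ^ 2 \<partial>lebesgue) = ennreal I"
    unfolding v2 using h by (intro nn_integral_lebesgue_continuous) (auto simp: less_imp_le)
  finally show ?thesis
    by (simp add: u2 ennreal_power)
qed

text \<open>Schur test for the averaging operator with general weights: \<open>K\<close> enters
  through an eigenvalue relation for h under two successive integrations, first from a to x and
  then, weighted by w, from t to b. Positivity of h is asked only on {a..<b} because the extremal
  function vanishes at b.\<close>

lemma weighted_hardy_inequality:
  fixes f h H w :: "real \<Rightarrow> real"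
  assumes f: "set_borel_measurable lebesgue {a..b} f"
    and h: "continuous_on {a..b} h" "\<And>t. t \<in> {a..<b} \<Longrightarrow> 0 < h t"
    and H: "continuous_on {a..b} H" "\<And>x. x \<in> {a..<b} \<Longrightarrow> (h has_integral H x) {a..x}"
      "\<And>x. x \<in> {a..b} \<Longrightarrow> 0 \<le> H x"
    and w: "continuous_on {a..b} w" "\<And>x. x \<in> {a..b} \<Longrightarrow> 0 \<le> w x"
    and K: "\<And>t. t \<in> {a..<b} \<Longrightarrow> ((\<lambda>x. w x * H x) has_integral K * h t) {t..b}"
  shows "(\<integral>\<^sup>+x. ennreal (w x * (LINT t:{a..x}|lebesgue. f t)\<^sup>2) * indicator {a..b} x \<partial>lebesgue)
    \<le> ennreal K * (\<integral>\<^sup>+x. ennreal ((f x)\<^sup>2) * indicator {a..b} x \<partial>lebesgue)"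
proof -
  interpret sigma_finite_measure "lebesgue :: real measure" by (rule sigma_finite_lebesgue)
  interpret P: pair_sigma_finite "lebesgue :: real measure" "lebesgue :: real measure" ..
  have mf[measurable]: "(\<lambda>t. indicator {a..b} t * f t) \<in> borel_measurable lebesgue"
    using f by (simp add: set_borel_measurable_def)
  have cont: "(\<lambda>t. indicator {a..b} t * g t) \<in> borel_measurable lebesgue"
    if "continuous_on {a..b} g" for g :: "real \<Rightarrow> real"
  proof -
    have "(\<lambda>t. indicator {a..b} t *\<^sub>R g t) \<in> borel_measurable borel"
      by (intro borel_measurable_continuous_on_indicator that) auto
    then show ?thesis by (simp add: measurable_completion)
  qed
  note [measurable] = cont[OF h(1)] cont[OF H(1)] cont[OF w(1)]
  \<comment> \<open>\<open>r\<close> is f^2 / h and \<open>s\<close> is w * H. The indicators of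
    {a..b} give measurability on the whole line; the factor for {a..<b} removes the point b, where h
    may vanish.\<close>
  define r where "r t = ennreal ((indicator {a..b} t * f t)\<^sup>2 / (indicator {a..b} t * h t)) * indicator {a..<b} t" for t
  define s where "s x = ennreal ((indicator {a..b} x * w x) * (indicator {a..b} x * H x)) * indicator {a..<b} x" for x
  have r: "r t = ennreal ((f t)\<^sup>2 / h t) * indicator {a..<b} t" for t
    by (auto simp: r_def indicator_def)
  have s: "s x = ennreal (w x * H x) * indicator {a..<b} x" for x
    by (auto simp: s_def indicator_def)
  have [measurable]: "{a..<b} \<in> sets lebesgue" "{..t} \<in> sets lebesgue" "{t..} \<in> sets lebesgue" for t :: real
    by simp_all
  have [measurable]: "r \<in> borel_measurable lebesgue" "s \<in> borel_measurable lebesgue"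
    unfolding r_def s_def by measurable
  have AEb: "AE x in lebesgue. x \<noteq> b"
    by (intro AE_completion AE_lborel_singleton)
  \<comment> \<open>Cauchy-Schwarz at a fixed x, with weight integral \<open>H x\<close>, multiplied
    by \<open>w x\<close>.\<close>
  have fst_bound: "ennreal (w x * (LINT t:{a..x}|lebesgue. f t)\<^sup>2)
      \<le> s x * (\<integral>\<^sup>+t. r t * indicator {..x} t \<partial>lebesgue)" if x: "x \<in> {a..<b}" for x
  proof -
    have "set_borel_measurable lebesgue {a..x} f"
      using x by (intro set_borel_measurable_subset[OF f]) auto
    moreover have "continuous_on {a..x} h"
      using x by (intro continuous_on_subset[OF h(1)]) auto
    ultimately have "ennreal ((LINT t:{a..x}|lebesgue. f t)\<^sup>2)
        \<le> (\<integral>\<^sup>+t. ennreal ((f t)\<^sup>2 / h t) * indicator {a..x} t \<partial>lebesgue) * ennreal (H x)"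
      using x h(2) H(2) by (intro square_integral_le_weighted) auto
    also have "(\<integral>\<^sup>+t. ennreal ((f t)\<^sup>2 / h t) * indicator {a..x} t \<partial>lebesgue)
        = (\<integral>\<^sup>+t. r t * indicator {..x} t \<partial>lebesgue)"
      using x by (intro nn_integral_cong) (auto simp: r indicator_def)
    finally have "ennreal (w x) * ennreal ((LINT t:{a..x}|lebesgue. f t)\<^sup>2)
      \<le> ennreal (w x) * ((\<integral>\<^sup>+t. r t * indicator {..x} t \<partial>lebesgue) * ennreal (H x))"
      by (rule mult_left_mono) simp
    then show ?thesis
      using x w(2)[of x] H(3)[of x] by (simp add: s ennreal_mult mult_ac)
  qed
  have "(\<integral>\<^sup>+x. ennreal (w x * (LINT t:{a..x}|lebesgue. f t)\<^sup>2) * indicator {a..b} x \<partial>lebesgue)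
    \<le> (\<integral>\<^sup>+x. s x * (\<integral>\<^sup>+t. r t * indicator {..x} t \<partial>lebesgue) \<partial>lebesgue)"
  proof (intro nn_integral_mono_AE eventually_mono[OF AEb])
    fix x assume "x \<noteq> b"
    then show "ennreal (w x * (LINT t:{a..x}|lebesgue. f t)\<^sup>2) * indicator {a..b} x
        \<le> s x * (\<integral>\<^sup>+t. r t * indicator {..x} t \<partial>lebesgue)"
      using fst_bound[of x] by (cases "x \<in> {a..b}") auto
  qed
  also have "\<dots> = (\<integral>\<^sup>+x. (\<integral>\<^sup>+t. s x * r t * indicator {(x, t). t \<le> x} (x, t) \<partial>lebesgue) \<partial>lebesgue)"
    by (intro nn_integral_cong, simp flip: nn_integral_cmult)
      (auto intro!: nn_integral_cong simp: indicator_def)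
  \<comment> \<open>Tonelli on the triangle t \<le> x. Its indicator is measurable for the product
    of the completed sigma-algebras because both coordinates are measurable into
    \<open>borel\<close>.\<close>
  also have "\<dots> = (\<integral>\<^sup>+t. (\<integral>\<^sup>+x. s x * r t * indicator {(x, t). t \<le> x} (x, t) \<partial>lebesgue) \<partial>lebesgue)"
  proof -
    have [measurable]: "(\<lambda>x. x) \<in> lebesgue \<rightarrow>\<^sub>M (borel :: real measure)"
      by (simp add: measurable_completion)
    have "{p \<in> space (lebesgue \<Otimes>\<^sub>M lebesgue). (snd p :: real) \<le> fst p} \<in> sets (lebesgue \<Otimes>\<^sub>M lebesgue)"
      by measurable
    also have "{p \<in> space (lebesgue \<Otimes>\<^sub>M lebesgue). (snd p :: real) \<le> fst p} = {(x, t). t \<le> x}"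
      by (auto simp: space_pair_measure)
    finally have [measurable]: "{(x, t). t \<le> x} \<in> sets (lebesgue \<Otimes>\<^sub>M (lebesgue :: real measure))" .
    show ?thesis by (intro P.Fubini'[symmetric]) measurable
  qed
  also have "\<dots> = (\<integral>\<^sup>+t. r t * (\<integral>\<^sup>+x. s x * indicator {t..} x \<partial>lebesgue) \<partial>lebesgue)"
    by (intro nn_integral_cong, simp flip: nn_integral_cmult)
      (auto intro!: nn_integral_cong simp: indicator_def mult_ac)
  \<comment> \<open>By the eigenvalue relation \<open>K\<close> the inner integral is K * h t, and
    this h t cancels the denominator of \<open>r t\<close>.\<close>
  also have "\<dots> = (\<integral>\<^sup>+t. ennreal K * (ennreal ((f t)\<^sup>2) * indicator {a..<b} t) \<partial>lebesgue)"
  proof (intro nn_integral_cong)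
    fix t
    show "r t * (\<integral>\<^sup>+x. s x * indicator {t..} x \<partial>lebesgue)
        = ennreal K * (ennreal ((f t)\<^sup>2) * indicator {a..<b} t)"
    proof (cases "t \<in> {a..<b}")
      case True
      have "(\<integral>\<^sup>+x. s x * indicator {t..} x \<partial>lebesgue)
          = (\<integral>\<^sup>+x. ennreal (w x * H x) * indicator {t..b} x \<partial>lebesgue)"
        using True by (intro nn_integral_cong_AE eventually_mono[OF AEb]) (auto simp: s indicator_def)
      also have "\<dots> = ennreal (K * h t)"
        using True w H(3) K[OF True]
        by (intro nn_integral_lebesgue_continuous continuous_intros mult_nonneg_nonneg
            continuous_on_subset[OF w(1)] continuous_on_subset[OF H(1)]) auto
      finally have "r t * (\<integral>\<^sup>+x. s x * indicator {t..} x \<partial>lebesgue)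
          = ennreal K * (ennreal ((f t)\<^sup>2 / h t) * ennreal (h t))"
        using True h(2)[OF True] by (simp add: r ennreal_mult'' mult_ac)
      also have "ennreal ((f t)\<^sup>2 / h t) * ennreal (h t) = ennreal ((f t)\<^sup>2)"
        using h(2)[OF True] by (simp flip: ennreal_mult)
      finally show ?thesis
        using True by simp
    qed (simp add: r)
  qed
  \<comment> \<open>The indicator of {a..b} goes back onto f so that the integrand is measurable and
    K can be pulled out.\<close>
  also have "\<dots> = (\<integral>\<^sup>+t. ennreal K * (ennreal ((indicator {a..b} t * f t)\<^sup>2) * indicator {a..<b} t) \<partial>lebesgue)"
    by (intro nn_integral_cong) (auto simp: indicator_def)
  also have "\<dots> = ennreal K * (\<integral>\<^sup>+t. ennreal ((indicator {a..b} t * f t)\<^sup>2) * indicator {a..<b} t \<partial>lebesgue)"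
    by (intro nn_integral_cmult) measurable
  also have "\<dots> \<le> ennreal K * (\<integral>\<^sup>+x. ennreal ((f x)\<^sup>2) * indicator {a..b} x \<partial>lebesgue)"
    by (intro mult_left_mono nn_integral_mono) (auto simp: indicator_def)
  finally show ?thesis .
qed

section \<open>The extremal function, its primitive and their derivatives\<close>

text \<open>On x > 0 this solves the Euler equation x^2 H'' + (1/4 + \<alpha>^2) H = 0 with H(a) =
  0; the factor 2 makes its derivative exactly \<open>hardy_extremal\<close>.\<close>

definition hardy_primitive :: "real \<Rightarrow> real \<Rightarrow> real \<Rightarrow> real" where
  "hardy_primitive a \<alpha> x = 2 * sqrt x * sin (\<alpha> * ln (x / a))"

lemma has_real_derivative_scaled_ln:
  fixes a x \<alpha> :: real
  assumes "0 < a" "0 < x"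
  shows "((\<lambda>x. \<alpha> * ln (x / a)) has_real_derivative \<alpha> / x) (at x within S)"
  using assms by (auto intro!: derivative_eq_intros)

lemma has_real_derivative_hardy_primitive:
  assumes "0 < a" "0 < x"
  shows "(hardy_primitive a \<alpha> has_real_derivative hardy_extremal a \<alpha> x) (at x within S)"
proof -
  have powr: "x powr (- 1 / 2) = 1 / sqrt x"
    using assms powr_minus[of x "1 / 2"] by (simp add: powr_half_sqrt inverse_eq_divide)
  \<comment> \<open>The product rule with r = sqrt x, C the cosine and D the sine; writing x as r *
    r makes it a rational identity.\<close>
  have alg: "2 * (inverse r / 2) * D + C * (\<alpha> / x) * (2 * r) = 1 / r * (2 * \<alpha> * C + D)"
    if "0 < r" "r * r = x" for r C D :: real
    using that(1) unfolding that(2)[symmetric] by (simp add: field_simps)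
  have "((\<lambda>x. 2 * sqrt x) has_real_derivative 2 * (inverse (sqrt x) / 2)) (at x within S)"
    using assms by (intro DERIV_cmult DERIV_subset[OF DERIV_real_sqrt]) auto
  moreover have "((\<lambda>x. sin (\<alpha> * ln (x / a))) has_real_derivative
      cos (\<alpha> * ln (x / a)) * (\<alpha> / x)) (at x within S)"
    by (intro DERIV_chain2[OF DERIV_sin] has_real_derivative_scaled_ln assms)
  ultimately have "(hardy_primitive a \<alpha> has_real_derivative
      2 * (inverse (sqrt x) / 2) * sin (\<alpha> * ln (x / a))
      + cos (\<alpha> * ln (x / a)) * (\<alpha> / x) * (2 * sqrt x)) (at x within S)"
    unfolding hardy_primitive_def [abs_def] by (intro DERIV_mult)
  then show ?thesis
    unfolding hardy_extremal_def powr using alg[of "sqrt x"] assms by simp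
qed

lemma has_real_derivative_hardy_extremal:
  assumes "0 < a" "0 < x"
  shows "(hardy_extremal a \<alpha> has_real_derivative
    - ((1 + 4 * \<alpha>\<^sup>2) / 4) * (hardy_primitive a \<alpha> x / x\<^sup>2)) (at x within S)"
proof -
  let ?C = "cos (\<alpha> * ln (x / a))" and ?S = "sin (\<alpha> * ln (x / a))"
  have eq: "x powr (- 1 / 2 - 1) = sqrt x / x\<^sup>2" "x powr (- 1 / 2) = sqrt x / x"
    using assms powr_diff[of x "1 / 2" 2] powr_diff[of x "1 / 2" 1] by (simp_all add: powr_half_sqrt)
  have "((\<lambda>x. x powr (- 1 / 2)) has_real_derivative (- 1 / 2) * (sqrt x / x\<^sup>2)) (at x within S)"
    using has_real_derivative_powr[OF assms(2), of "- 1 / 2"] unfolding eq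
    by (rule DERIV_subset) simp
  moreover have "((\<lambda>x. 2 * \<alpha> * cos (\<alpha> * ln (x / a)) + sin (\<alpha> * ln (x / a))) has_real_derivative
      2 * \<alpha> * (- ?S * (\<alpha> / x)) + ?C * (\<alpha> / x)) (at x within S)"
    by (intro DERIV_add DERIV_cmult DERIV_chain2[OF DERIV_sin] DERIV_chain2[OF DERIV_cos]
        has_real_derivative_scaled_ln assms)
  ultimately have "(hardy_extremal a \<alpha> has_real_derivative
      (- 1 / 2) * (sqrt x / x\<^sup>2) * (2 * \<alpha> * ?C + ?S)
      + (2 * \<alpha> * (- ?S * (\<alpha> / x)) + ?C * (\<alpha> / x)) * (sqrt x / x)) (at x within S)"
    unfolding hardy_extremal_def [abs_def] eq(2)[symmetric] by (rule DERIV_mult)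
  \<comment> \<open>The cosine terms -\<alpha> C and \<alpha> C cancel, and the sine terms add up to
    -(1/2 + 2 \<alpha>^2) D, which is the source of the constant 1 + 4 \<alpha>^2.\<close>
  moreover have "(- 1 / 2) * (r / x\<^sup>2) * (2 * \<alpha> * C + D) + (2 * \<alpha> * (- D * (\<alpha> / x)) + C * (\<alpha> / x)) * (r / x)
      = - ((1 + 4 * \<alpha>\<^sup>2) / 4) * (2 * r * D / x\<^sup>2)" for r C D :: real
    using assms by (simp add: field_simps power2_eq_square)
  ultimately show ?thesis
    by (simp only: hardy_primitive_def)
qed

section \<open>The root \<alpha> and the signs of the extremal function and its primitive\<close>

text \<open>Existence comes from the intermediate value theorem, uniqueness from the strict growth
  of both tan(\<alpha> L) and 2 \<alpha> on the interval.\<close>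

lemma ex1_hardy_root:
  assumes "0 < a" "a < b"
  shows "\<exists>!\<alpha>. hardy_root a b \<alpha>"
proof -
  define L where "L = ln (b / a)"
  have L: "0 < L"
    using assms by (simp add: L_def)
  have root: "hardy_root a b \<alpha> \<longleftrightarrow> pi / 2 < \<alpha> * L \<and> \<alpha> * L < pi \<and> tan (\<alpha> * L) + 2 * \<alpha> = 0" for \<alpha>
    using L by (auto simp: hardy_root_def L_def[symmetric] field_simps)
  \<comment> \<open>The equation multiplied by the cosine, which removes the pole of the tangent at
    pi / 2. \<open>?g\<close> equals 1 at the left end and -2 pi / L at the right end, so its zero
    is interior.\<close>
  let ?g = "\<lambda>\<alpha>. sin (\<alpha> * L) + 2 * \<alpha> * cos (\<alpha> * L)"
  have "\<exists>\<alpha>\<ge>pi / (2 * L). \<alpha> \<le> pi / L \<and> ?g \<alpha> = 0"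
    using L by (intro IVT2') (auto intro!: continuous_intros simp: field_simps)
  then obtain \<alpha> where \<alpha>: "pi / (2 * L) \<le> \<alpha>" "\<alpha> \<le> pi / L" "?g \<alpha> = 0"
    by blast
  have "\<alpha> \<noteq> pi / (2 * L)" "\<alpha> \<noteq> pi / L"
    using \<alpha>(3) L by auto
  with \<alpha> L have int: "pi / 2 < \<alpha> * L" "\<alpha> * L < pi"
    by (auto simp: field_simps)
  then have "cos (\<alpha> * L) < 0"
    using cos_monotone_0_pi[of "pi / 2" "\<alpha> * L"] by simp
  then have "hardy_root a b \<alpha>"
    using int \<alpha>(3) by (simp add: root tan_def field_simps)
  moreover have "\<not> (hardy_root a b \<beta> \<and> hardy_root a b \<gamma> \<and> \<beta> < \<gamma>)" for \<beta> \<gamma>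
  proof (intro notI, elim conjE)
    assume *: "hardy_root a b \<beta>" "hardy_root a b \<gamma>" "\<beta> < \<gamma>"
    \<comment> \<open>Subtracting pi moves both angles into (-pi/2, 0), inside the branch where the
      tangent is known to increase.\<close>
    have "tan (\<beta> * L - pi) < tan (\<gamma> * L - pi)"
      using * L by (intro tan_monotone) (auto simp: root)
    then show False
      using * tan_periodic_pi[of "\<beta> * L - pi"] tan_periodic_pi[of "\<gamma> * L - pi"] by (simp add: root)
  qed
  ultimately show ?thesis
    by (metis linorder_less_linear)
qed

lemma hardy_root_pos:
  assumes "0 < a" "a < b" "hardy_root a b \<alpha>"
  shows "0 < \<alpha>"
proof -
  have "0 < pi / (2 * ln (b / a))"
    using assms by simp
  also have "\<dots> < \<alpha>"
    using assms by (simp add: hardy_root_def)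
  finally show ?thesis .
qed

lemma hardy_angle:
  assumes "0 < a" "a < b" "hardy_root a b \<alpha>"
  shows "pi / 2 < \<alpha> * ln (b / a)" "\<alpha> * ln (b / a) < pi"
proof -
  have "0 < ln (b / a)"
    using assms by simp
  then show "pi / 2 < \<alpha> * ln (b / a)" "\<alpha> * ln (b / a) < pi"
    using assms(3) by (auto simp: hardy_root_def field_simps)
qed

text \<open>For x in {a..b} the angle \<alpha> ln(x / a) stays in [0, pi), where the sine is
  nonnegative.\<close>

lemma hardy_primitive_nonneg:
  assumes "0 < a" "a < b" "hardy_root a b \<alpha>" "x \<in> {a..b}"
  shows "0 \<le> hardy_primitive a \<alpha> x"
proof -
  have "0 \<le> ln (x / a)" "ln (x / a) \<le> ln (b / a)"
    using assms by (auto simp: divide_right_mono)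
  then have "0 \<le> \<alpha> * ln (x / a)" "\<alpha> * ln (x / a) \<le> \<alpha> * ln (b / a)"
    using hardy_root_pos[OF assms(1-3)] by auto
  then show ?thesis
    using hardy_angle[OF assms(1-3)] assms
    by (auto simp: hardy_primitive_def intro!: mult_nonneg_nonneg sin_ge_zero)
qed

text \<open>Multiplied by the nonzero cosine, the equation for \<alpha> says that the trigonometric
  factor vanishes at x = b.\<close>

lemma hardy_extremal_right_end:
  assumes "0 < a" "a < b" "hardy_root a b \<alpha>"
  shows "hardy_extremal a \<alpha> b = 0"
proof -
  have "cos (\<alpha> * ln (b / a)) \<noteq> 0"
    using hardy_angle[OF assms] cos_monotone_0_pi[of "pi / 2" "\<alpha> * ln (b / a)"] by simp
  then show ?thesis
    using assms(3) by (simp add: hardy_extremal_def hardy_root_def tan_def field_simps)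
qed

text \<open>Only the factor 2 \<alpha> cos \<theta> + sin \<theta> matters. Up to pi / 2 neither
  term is negative and one is positive; beyond it \<theta> is compared with the endpoint angle,
  where the factor is zero.\<close>

lemma hardy_extremal_pos:
  assumes "0 < a" "a < b" "hardy_root a b \<alpha>" "x \<in> {a..<b}"
  shows "0 < hardy_extremal a \<alpha> x"
proof -
  define \<theta> where "\<theta> = \<alpha> * ln (x / a)"
  have \<alpha>: "0 < \<alpha>"
    by (rule hardy_root_pos[OF assms(1-3)])
  have "0 \<le> ln (x / a)" "ln (x / a) < ln (b / a)"
    using assms by (auto simp: divide_strict_right_mono)
  then have \<theta>: "0 \<le> \<theta>" "\<theta> < \<alpha> * ln (b / a)"
    using \<alpha> by (auto simp: \<theta>_def)
  have "0 < 2 * \<alpha> * cos \<theta> + sin \<theta>"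
  proof (cases "\<theta> \<le> pi / 2")
    case True
    show ?thesis
    proof (cases "\<theta> = 0")
      case False
      have "0 \<le> cos \<theta>" "0 < sin \<theta>"
        using \<theta> True False by (auto intro!: cos_ge_zero sin_gt_zero)
      then show ?thesis
        using \<alpha> by (simp add: add_nonneg_pos)
    qed (use \<alpha> in simp)
  next
    case False
    note ang = hardy_angle[OF assms(1-3)]
    \<comment> \<open>On the branch (pi/2, pi) the tangent increases up to its endpoint value -2
      \<alpha>; multiplying by the negative cosine below then reverses the inequality.\<close>
    have "tan (\<theta> - pi) < tan (\<alpha> * ln (b / a) - pi)"
      using ang \<theta> False by (intro tan_monotone) auto
    then have "tan \<theta> < - 2 * \<alpha>"
      using assms(3) tan_periodic_pi[of "\<theta> - pi"] tan_periodic_pi[of "\<alpha> * ln (b / a) - pi"]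
      by (simp add: hardy_root_def)
    moreover have "cos \<theta> < 0"
      using cos_monotone_0_pi[of "pi / 2" \<theta>] False \<theta> ang by simp
    ultimately show ?thesis
      by (simp add: tan_def field_simps)
  qed
  then show ?thesis
    using assms by (simp add: hardy_extremal_def \<theta>_def)
qed

section \<open>Integral identities and the equality case\<close>

lemma continuous_on_hardy:
  assumes "0 < a"
  shows "continuous_on {a..x} (hardy_extremal a \<alpha>)" "continuous_on {a..x} (hardy_primitive a \<alpha>)"
  using assms
  by (auto intro!: DERIV_continuous_on has_real_derivative_hardy_extremal
      has_real_derivative_hardy_primitive)

lemma has_integral_hardy_extremal:
  assumes "0 < a" "a \<le> x"
  shows "(hardy_extremal a \<alpha> has_integral hardy_primitive a \<alpha> x) {a..x}"
proof -
  have "(hardy_extremal a \<alpha> has_integral hardy_primitive a \<alpha> x - hardy_primitive a \<alpha> a) {a..x}"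
    using assms by (intro fundamental_theorem_of_calculus)
      (auto simp flip: has_real_derivative_iff_has_vector_derivative
        intro!: has_real_derivative_hardy_primitive)
  then show ?thesis
    using assms by (simp add: hardy_primitive_def)
qed

text \<open>Supplies the eigenvalue relation of the Schur test: integrate the formula for h' over
  {t..b}, where the boundary term at b drops out, and divide by the constant.\<close>

lemma has_integral_hardy_primitive_weighted:
  assumes "0 < a" "a < b" "hardy_root a b \<alpha>" "t \<in> {a..b}"
  shows "((\<lambda>x. 1 / x\<^sup>2 * hardy_primitive a \<alpha> x) has_integral
    4 / (1 + 4 * \<alpha>\<^sup>2) * hardy_extremal a \<alpha> t) {t..b}"
proof -
  have pos: "0 < 1 + 4 * \<alpha>\<^sup>2"
    by (rule add_pos_nonneg) auto
  have "((\<lambda>x. - ((1 + 4 * \<alpha>\<^sup>2) / 4) * (hardy_primitive a \<alpha> x / x\<^sup>2)) has_integral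
      hardy_extremal a \<alpha> b - hardy_extremal a \<alpha> t) {t..b}"
    using assms by (intro fundamental_theorem_of_calculus)
      (auto simp flip: has_real_derivative_iff_has_vector_derivative
        intro!: has_real_derivative_hardy_extremal[THEN DERIV_cong])
  then have "((\<lambda>x. - (4 / (1 + 4 * \<alpha>\<^sup>2)) *
      (- ((1 + 4 * \<alpha>\<^sup>2) / 4) * (hardy_primitive a \<alpha> x / x\<^sup>2))) has_integral
      - (4 / (1 + 4 * \<alpha>\<^sup>2)) * (hardy_extremal a \<alpha> b - hardy_extremal a \<alpha> t)) {t..b}"
    by (rule has_integral_mult_right)
  then show ?thesis
    using pos by (simp add: hardy_extremal_right_end[OF assms(1-3)])
qed

lemma hardy_extremal_equality:
  assumes "0 < a" "a < b" "hardy_root a b \<alpha>"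
  shows "(LINT x:{a..b}|lebesgue. (1 / x * (LINT t:{a..x}|lebesgue. hardy_extremal a \<alpha> t))\<^sup>2)
    = 4 / (1 + 4 * \<alpha>\<^sup>2) * (LINT x:{a..b}|lebesgue. (hardy_extremal a \<alpha> x)\<^sup>2)"
proof -
  let ?h = "hardy_extremal a \<alpha>" and ?H = "hardy_primitive a \<alpha>"
  have pos: "0 < 1 + 4 * \<alpha>\<^sup>2"
    by (rule add_pos_nonneg) auto
  \<comment> \<open>By continuity the Lebesgue integral agrees with the gauge integral, which the
    fundamental theorem evaluates.\<close>
  have inner: "(LINT t:{a..x}|lebesgue. ?h t) = ?H x" if "a \<le> x" for x
    using set_lebesgue_integral_eq_integral(2)[OF absolutely_integrable_continuous_real]
      continuous_on_hardy(1)[OF assms(1)] integral_unique[OF has_integral_hardy_extremal[OF assms(1) that]]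
    by metis
  have "(LINT x:{a..b}|lebesgue. (1 / x * (LINT t:{a..x}|lebesgue. ?h t))\<^sup>2)
      = (LINT x:{a..b}|lebesgue. (1 / x * ?H x)\<^sup>2)"
    by (intro set_lebesgue_integral_cong) (auto simp: inner)
  also have "\<dots> = integral {a..b} (\<lambda>x. (1 / x * ?H x)\<^sup>2)"
    using assms by (intro set_lebesgue_integral_eq_integral absolutely_integrable_continuous_real
        continuous_intros continuous_on_hardy) auto
  also have "\<dots> = 4 / (1 + 4 * \<alpha>\<^sup>2) * integral {a..b} (\<lambda>x. (?h x)\<^sup>2)"
  proof -
    \<comment> \<open>The integrand is (h H)'. Its integral vanishes since h(b) = 0 and H(a) = 0,
      which ties the two quadratic integrals together.\<close>
    have "((\<lambda>x. ?h x * ?h x + - ((1 + 4 * \<alpha>\<^sup>2) / 4) * (?H x / x\<^sup>2) * ?H x)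
        has_integral ?h b * ?H b - ?h a * ?H a) {a..b}"
      using assms by (intro fundamental_theorem_of_calculus)
        (auto simp flip: has_real_derivative_iff_has_vector_derivative
          intro!: derivative_eq_intros has_real_derivative_hardy_extremal has_real_derivative_hardy_primitive)
    moreover have "?h b * ?H b - ?h a * ?H a = 0"
      using assms by (simp add: hardy_extremal_right_end hardy_primitive_def)
    moreover have "?h x * ?h x + - ((1 + 4 * \<alpha>\<^sup>2) / 4) * (?H x / x\<^sup>2) * ?H x
        = (?h x)\<^sup>2 - (1 + 4 * \<alpha>\<^sup>2) / 4 * (1 / x * ?H x)\<^sup>2" for x
      by (simp add: power2_eq_square)
    ultimately have "((\<lambda>x. (?h x)\<^sup>2 - (1 + 4 * \<alpha>\<^sup>2) / 4 * (1 / x * ?H x)\<^sup>2) has_integral 0) {a..b}"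
      by simp
    then have "0 = integral {a..b} (\<lambda>x. (?h x)\<^sup>2 - (1 + 4 * \<alpha>\<^sup>2) / 4 * (1 / x * ?H x)\<^sup>2)"
      by (simp add: integral_unique)
    also have "\<dots> = integral {a..b} (\<lambda>x. (?h x)\<^sup>2)
        - integral {a..b} (\<lambda>x. (1 + 4 * \<alpha>\<^sup>2) / 4 * (1 / x * ?H x)\<^sup>2)"
      using assms by (intro integral_diff integrable_continuous_real continuous_intros continuous_on_hardy) auto
    finally have "integral {a..b} (\<lambda>x. (?h x)\<^sup>2) = (1 + 4 * \<alpha>\<^sup>2) / 4 * integral {a..b} (\<lambda>x. (1 / x * ?H x)\<^sup>2)"
      by simp
    then show ?thesis
      using pos by (simp only: field_simps) simp
  qed
  also have "integral {a..b} (\<lambda>x. (?h x)\<^sup>2) = (LINT x:{a..b}|lebesgue. (?h x)\<^sup>2)"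
    using assms by (intro set_lebesgue_integral_eq_integral(2)[symmetric] absolutely_integrable_continuous_real
        continuous_intros continuous_on_hardy)
  finally show ?thesis .
qed

section \<open>Square integrability, the inequality and the conclusion\<close>

lemma continuous_on_imp_L2_interval:
  assumes "continuous_on {a..b} f"
  shows "f \<in> L2_interval a b"
proof -
  have "(\<lambda>x. indicator {a..b} x *\<^sub>R f x) \<in> borel_measurable borel"
    by (intro borel_measurable_continuous_on_indicator assms) auto
  moreover have "set_integrable lebesgue {a..b} (\<lambda>x. (f x)\<^sup>2)"
    by (intro absolutely_integrable_continuous_real continuous_intros assms)
  ultimately show ?thesis
    by (simp add: L2_interval_def set_borel_measurable_def measurable_completion)
qed

text \<open>The Schur test with w = 1 / x^2 and K = 4 / (1 + 4 \<alpha>^2), carried over from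
  extended nonnegative integrals to real ones.\<close>

lemma hardy_inequality:
  assumes "0 < a" "a < b" "hardy_root a b \<alpha>" "f \<in> L2_interval a b"
  shows "(LINT x:{a..b}|lebesgue. (1 / x * (LINT t:{a..x}|lebesgue. f t))\<^sup>2)
    \<le> 4 / (1 + 4 * \<alpha>\<^sup>2) * (LINT x:{a..b}|lebesgue. (f x)\<^sup>2)"
proof -
  let ?F = "\<lambda>x. LINT t:{a..x}|lebesgue. f t"
  have f: "set_borel_measurable lebesgue {a..b} f" "set_integrable lebesgue {a..b} (\<lambda>x. (f x)\<^sup>2)"
    using assms(4) by (auto simp: L2_interval_def)
  have C: "0 \<le> 4 / (1 + 4 * \<alpha>\<^sup>2)"
    by simp
  have I: "0 \<le> (LINT x:{a..b}|lebesgue. (f x)\<^sup>2)"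
    by (simp add: set_lebesgue_integral_def)
  have "(\<integral>\<^sup>+x. ennreal (indicator {a..b} x *\<^sub>R (1 / x * ?F x)\<^sup>2) \<partial>lebesgue)
      = (\<integral>\<^sup>+x. ennreal (1 / x\<^sup>2 * (?F x)\<^sup>2) * indicator {a..b} x \<partial>lebesgue)"
    by (intro nn_integral_cong) (simp add: indicator_def power_divide)
  also have "\<dots> \<le> ennreal (4 / (1 + 4 * \<alpha>\<^sup>2))
      * (\<integral>\<^sup>+x. ennreal ((f x)\<^sup>2) * indicator {a..b} x \<partial>lebesgue)"
  proof (rule weighted_hardy_inequality[where h = "hardy_extremal a \<alpha>" and H = "hardy_primitive a \<alpha>"])
    show "continuous_on {a..b} (\<lambda>x. 1 / x\<^sup>2)"
      using assms(1) by (intro continuous_intros) auto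
  qed (use assms f has_integral_hardy_extremal hardy_extremal_pos hardy_primitive_nonneg
      has_integral_hardy_primitive_weighted continuous_on_hardy in auto)
  also have "(\<integral>\<^sup>+x. ennreal ((f x)\<^sup>2) * indicator {a..b} x \<partial>lebesgue)
      = (\<integral>\<^sup>+x. ennreal (indicator {a..b} x *\<^sub>R (f x)\<^sup>2) \<partial>lebesgue)"
    by (intro nn_integral_cong) (simp add: indicator_def)
  \<comment> \<open>Here square integrability of f enters: it makes the right-hand side
    finite.\<close>
  also have "\<dots> = ennreal (LINT x:{a..b}|lebesgue. (f x)\<^sup>2)"
    unfolding set_lebesgue_integral_def using f(2)
    by (intro nn_integral_eq_integral) (auto simp: set_integrable_def)
  also have "ennreal (4 / (1 + 4 * \<alpha>\<^sup>2)) * \<dots>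
      = ennreal (4 / (1 + 4 * \<alpha>\<^sup>2) * (LINT x:{a..b}|lebesgue. (f x)\<^sup>2))"
    using C I by (rule ennreal_mult[symmetric])
  \<comment> \<open>The right-hand side is nonnegative, so it also dominates the default value 0
    that a non-integrable left-hand integrand would give.\<close>
  finally show ?thesis
    unfolding set_lebesgue_integral_def[of lebesgue "{a..b}" "\<lambda>x. (1 / x * ?F x)\<^sup>2"]
    using C I by (intro integral_real_bounded mult_nonneg_nonneg)
qed

theorem theorem1p1:
  fixes a b :: real
  assumes "0 < a" and "a < b"
  shows "(\<exists>!\<alpha>. hardy_root a b \<alpha>) \<and>
    (\<forall>\<alpha>. hardy_root a b \<alpha> \<longrightarrow>
       (\<forall>f \<in> L2_interval a b.
          (LINT x:{a..b}|lebesgue. (1 / x * (LINT t:{a..x}|lebesgue. f t))\<^sup>2)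
            \<le> 4 / (1 + 4 * \<alpha>\<^sup>2) * (LINT x:{a..b}|lebesgue. (f x)\<^sup>2)) \<and>
       hardy_extremal a \<alpha> \<in> L2_interval a b \<and>
       (LINT x:{a..b}|lebesgue. (1 / x * (LINT t:{a..x}|lebesgue. hardy_extremal a \<alpha> t))\<^sup>2)
         = 4 / (1 + 4 * \<alpha>\<^sup>2) * (LINT x:{a..b}|lebesgue. (hardy_extremal a \<alpha> x)\<^sup>2))"
proof (intro conjI allI impI ballI)
  show "\<exists>!\<alpha>. hardy_root a b \<alpha>"
    by (rule ex1_hardy_root[OF assms])
next
  fix \<alpha> f
  assume "hardy_root a b \<alpha>" "f \<in> L2_interval a b"
  then show "(LINT x:{a..b}|lebesgue. (1 / x * (LINT t:{a..x}|lebesgue. f t))\<^sup>2)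
      \<le> 4 / (1 + 4 * \<alpha>\<^sup>2) * (LINT x:{a..b}|lebesgue. (f x)\<^sup>2)"
    by (rule hardy_inequality[OF assms])
next
  fix \<alpha>
  assume "hardy_root a b \<alpha>"
  then show "(LINT x:{a..b}|lebesgue. (1 / x * (LINT t:{a..x}|lebesgue. hardy_extremal a \<alpha> t))\<^sup>2)
      = 4 / (1 + 4 * \<alpha>\<^sup>2) * (LINT x:{a..b}|lebesgue. (hardy_extremal a \<alpha> x)\<^sup>2)"
    by (rule hardy_extremal_equality[OF assms])
  show "hardy_extremal a \<alpha> \<in> L2_interval a b"
    by (intro continuous_on_imp_L2_interval continuous_on_hardy assms)
qed

end
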